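(* Let $\mathcal{A}$ be a proper minor-closed class of graphs, let $k \geq 2$, and suppose that $2-\frac{1}{k-1} \leq \beta_{\mathcal{A}} < 2-\frac1k$. Then: (a) either $\beta_{\mathcal{A}} = 2-\frac{1}{k-1}$, or there exist integers $m \geq 1$ and $0 \leq t \leq k-1$ such that, with $n = mk+1+t$, we have $n > (2k-1-t)(k-1)$ and $$\beta_{\mathcal{A}} = 2-\frac{1}{k} - \frac{2k-t-1}{kn};$$ (b) each such value (that is, $2-\frac{1}{k-1}$, and each value $2-\frac1k-\frac{2k-t-1}{kn}$ with $n=mk+1+t$, $m\ge1$, $0\le t\le k-1$, $n>(2k-1-t)(k-1)$) is the density $\rho(G)$ of some minor-balanced graph $G$.
   Context: All graphs are finite and simple. $\rho(G)=e(G)/v(G)$ is the density of $G$. A class of graphs (closed under isomorphism) is proper if it is non-empty and does not contain all graphs, and minor-closed if it contains all minors of its members. $\beta_{\mathcal{A}}=\sup_{G\in\mathcal{A}}\rho(G)$. A graph $G$ is minor-balanced if every minor of $G$ has density at most $\rho(G)$. *)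

theory Defs
  imports Complex_Main "HOL-Library.Extended_Real"
begin

type_synonym 'a ugraph = "'a set \<times> 'a set set"

abbreviation verts :: "'a ugraph \<Rightarrow> 'a set" where "verts G \<equiv> fst G"
abbreviation edges :: "'a ugraph \<Rightarrow> 'a set set" where "edges G \<equiv> snd G"

text \<open>The null graph is excluded, since the density \<open>e(G)/v(G)\<close> is undefined for it.\<close>

definition fin_sgraph :: "'a ugraph \<Rightarrow> bool" where
  "fin_sgraph G \<longleftrightarrow> finite (verts G) \<and> verts G \<noteq> {} \<and>
     (\<forall>e \<in> edges G. e \<subseteq> verts G \<and> card e = 2)"

definition edge_density :: "'a ugraph \<Rightarrow> real" where
  "edge_density G = real (card (edges G)) / real (card (verts G))"

definition graph_iso :: "'a ugraph \<Rightarrow> 'b ugraph \<Rightarrow> bool" where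
  "graph_iso G H \<longleftrightarrow> (\<exists>f. bij_betw f (verts G) (verts H) \<and> edges H = (image f) ` edges G)"

definition delete_vertex :: "'a ugraph \<Rightarrow> 'a \<Rightarrow> 'a ugraph" where
  "delete_vertex G v = (verts G - {v}, {e \<in> edges G. v \<notin> e})"

definition delete_edge :: "'a ugraph \<Rightarrow> 'a set \<Rightarrow> 'a ugraph" where
  "delete_edge G e = (verts G, edges G - {e})"

text \<open>Contracting the edge \<open>{u, v}\<close> identifies \<open>v\<close> with \<open>u\<close>. The contracted edge is the only
  one that would become a loop, and parallel edges are merged because edges form a set.\<close>

definition contract_edge :: "'a ugraph \<Rightarrow> 'a \<Rightarrow> 'a \<Rightarrow> 'a ugraph" where
  "contract_edge G u v =
     (verts G - {v}, image (\<lambda>w. if w = v then u else w) ` (edges G - {{u, v}}))"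

inductive minor_step :: "'a ugraph \<Rightarrow> 'a ugraph \<Rightarrow> bool" for G :: "'a ugraph" where
  del_vertex: "v \<in> verts G \<Longrightarrow> verts G \<noteq> {v} \<Longrightarrow> minor_step G (delete_vertex G v)"
| del_edge: "e \<in> edges G \<Longrightarrow> minor_step G (delete_edge G e)"
| contract: "{u, v} \<in> edges G \<Longrightarrow> u \<noteq> v \<Longrightarrow> minor_step G (contract_edge G u v)"

definition minor_of :: "'b ugraph \<Rightarrow> 'a ugraph \<Rightarrow> bool" where
  "minor_of H G \<longleftrightarrow> (\<exists>H'. minor_step\<^sup>*\<^sup>* G H' \<and> graph_iso H' H)"

text \<open>Every minor of \<open>G\<close> has an isomorphic copy on a subset of the vertices of \<open>G\<close>, so it is
  enough to let \<open>H\<close> range over graphs with the same vertex type.\<close>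

definition minor_balanced :: "'a ugraph \<Rightarrow> bool" where
  "minor_balanced G \<longleftrightarrow> (\<forall>H :: 'a ugraph. minor_of H G \<longrightarrow> edge_density H \<le> edge_density G)"

text \<open>Every finite graph is isomorphic to one with vertices in \<open>nat\<close>, so an isomorphism-closed
  class of graphs is represented by its members with vertices in \<open>nat\<close>.\<close>

definition graph_class :: "nat ugraph set \<Rightarrow> bool" where
  "graph_class A \<longleftrightarrow> (\<forall>G \<in> A. fin_sgraph G) \<and>
     (\<forall>G \<in> A. \<forall>H. fin_sgraph H \<and> graph_iso G H \<longrightarrow> H \<in> A)"

definition proper_class :: "nat ugraph set \<Rightarrow> bool" where
  "proper_class A \<longleftrightarrow> A \<noteq> {} \<and> (\<exists>G. fin_sgraph G \<and> G \<notin> A)"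

definition minor_closed :: "nat ugraph set \<Rightarrow> bool" where
  "minor_closed A \<longleftrightarrow> (\<forall>G \<in> A. \<forall>H. minor_of H G \<longrightarrow> H \<in> A)"

text \<open>The supremum is taken in the extended reals, so that no boundedness is presupposed.\<close>

definition sup_density :: "nat ugraph set \<Rightarrow> ereal" where
  "sup_density A = (SUP G\<in>A. ereal (edge_density G))"

lemma fin_sgraph_minor_step:
  assumes "fin_sgraph G" "minor_step G H"
  shows "fin_sgraph H"
  using assms(2)
proof cases
  case (del_vertex v)
  then show ?thesis using assms(1) by (auto simp: fin_sgraph_def delete_vertex_def)
next
  case (del_edge e)
  then show ?thesis using assms(1) by (auto simp: fin_sgraph_def delete_edge_def)
next
  case (contract u v)
  let ?f = "\<lambda>w. if w = v then u else w"
  have H: "H = contract_edge G u v" and ne: "u \<noteq> v" and uvE: "{u, v} \<in> edges G"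
    using contract by blast+
  have sub: "e \<subseteq> verts G" and c2: "card e = 2" if "e \<in> edges G" for e
    using assms(1) that unfolding fin_sgraph_def by blast+
  have uv: "u \<in> verts G" "v \<in> verts G" using sub[OF uvE] by blast+
  have *: "?f ` e \<subseteq> verts G - {v} \<and> card (?f ` e) = 2"
    if e: "e \<in> edges G" "e \<noteq> {u, v}" for e
  proof -
    obtain a b where ab: "e = {a, b}" "a \<noteq> b" using c2[OF e(1)] unfolding card_2_iff by blast
    have "?f a \<noteq> ?f b" using e(2) ab by (metis insert_commute)
    then have "card {?f a, ?f b} = 2" by (rule card_2_iff[THEN iffD2, OF exI, OF exI, OF conjI, OF refl])
    moreover have "?f ` e = {?f a, ?f b}" unfolding ab(1) by (simp only: image_insert image_empty)
    moreover have "?f ` e \<subseteq> verts G - {v}"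
    proof (rule image_subsetI)
      show "?f w \<in> verts G - {v}" if "w \<in> e" for w
        using that sub[OF e(1)] uv ne by auto
    qed
    ultimately show ?thesis by simp
  qed
  have "finite (verts H)" "verts H \<noteq> {}"
    using assms(1) uv ne unfolding H contract_edge_def fin_sgraph_def by auto
  moreover have "\<forall>e \<in> edges H. e \<subseteq> verts H \<and> card e = 2"
    unfolding H contract_edge_def fst_conv snd_conv using * by blast
  ultimately show ?thesis unfolding fin_sgraph_def by blast
qed

lemma fin_sgraph_iso:
  assumes "fin_sgraph G" "graph_iso G H"
  shows "fin_sgraph H"
proof -
  obtain f where f: "bij_betw f (verts G) (verts H)" "edges H = (image f) ` edges G"
    using assms(2) by (auto simp: graph_iso_def)
  have "f ` e \<subseteq> verts H \<and> card (f ` e) = 2" if "e \<in> edges G" for e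
  proof -
    have e: "e \<subseteq> verts G" "card e = 2" using assms(1) that by (auto simp: fin_sgraph_def)
    then have "inj_on f e" using f(1) by (auto simp: bij_betw_def intro: inj_on_subset)
    then show ?thesis using e f(1) by (auto simp: bij_betw_def card_image)
  qed
  moreover have "finite (verts H)" "verts H \<noteq> {}"
    using f(1) assms(1) bij_betw_finite[OF f(1)] by (auto simp: fin_sgraph_def bij_betw_def)
  ultimately show ?thesis using f(2) by (auto simp: fin_sgraph_def)
qed

lemma fin_sgraph_minor:
  assumes "fin_sgraph G" "minor_of H G"
  shows "fin_sgraph H"
proof -
  obtain H' where "minor_step\<^sup>*\<^sup>* G H'" "graph_iso H' H"
    using assms(2) by (auto simp: minor_of_def)
  from this(1) have "fin_sgraph H'"
    by (induction rule: rtranclp_induct) (use assms(1) fin_sgraph_minor_step in auto)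
  then show ?thesis using \<open>graph_iso H' H\<close> by (rule fin_sgraph_iso)
qed

end

theory Submission
  imports Defs
begin

text \<open>
  Call a graph critical for \<open>\<rho> > 2 - 1/(k-1)\<close> if its density is at least \<open>\<rho>\<close> and that of every
  proper minor is smaller. Contracting a connected set of \<open>j + 1 \<le> k\<close> vertices of a critical graph
  destroys at least \<open>2j\<close> edges, so a vertex set can be enlarged repeatedly, either by \<open>j\<close> vertices
  that bring \<open>2j\<close> edges or by \<open>k\<close> vertices that bring \<open>2k - 1\<close>. Hence a critical graph satisfies
  \<open>e \<ge> (2 - 1/k)(n - 1)\<close>. If all densities stay below some \<open>\<beta> < 2 - 1/k\<close>, this bounds \<open>n\<close>, so the
  supremum is attained by a critical graph, and the inequality confines its value to the stated list.

  Conversely, a hub joined to \<open>m - 1\<close> paths on \<open>k\<close> vertices and one path on \<open>k + t\<close> vertices has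
  the required density. Its minors are again subgraphs of such fans with shorter or fewer paths.
  A fan with \<open>b \<le> m\<close> nonempty paths has \<open>h \<le> bk + t + 1\<close> vertices and at most \<open>2(h - 1) - b\<close> edges,
  and \<open>2 - (b + 2)/(bk + t + 1)\<close> increases with \<open>b\<close>. For \<open>t = 0\<close> and \<open>m = 2k - 3\<close> the density
  is \<open>2 - 1/(k-1)\<close>.
\<close>

section \<open>Minors obtained by deleting or contracting a set of vertices\<close>

lemma finite_edges:
  assumes "fin_sgraph G"
  shows "finite (edges G)"
  using assms by (intro finite_subset[of "edges G" "Pow (verts G)"]) (auto simp: fin_sgraph_def)

lemma graph_iso_refl: "graph_iso G G"
  unfolding graph_iso_def by (rule exI[of _ id]) auto

lemma edge_density_iso:
  assumes "fin_sgraph G" "graph_iso G H"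
  shows "edge_density H = edge_density G"
proof -
  obtain f where f: "bij_betw f (verts G) (verts H)" "edges H = (image f) ` edges G"
    using assms(2) by (auto simp: graph_iso_def)
  have "inj_on (image f) (Pow (verts G))"
    using f(1) by (simp add: bij_betw_def inj_on_image_Pow)
  then have "inj_on (image f) (edges G)"
    by (rule inj_on_subset) (use assms(1) in \<open>auto simp: fin_sgraph_def\<close>)
  then show ?thesis
    using bij_betw_same_card[OF f(1)] by (simp add: edge_density_def f(2) card_image)
qed

text \<open>The strict inclusion leaves a vertex at every stage, as \<open>del_vertex\<close>
  demands.\<close>

lemma delete_vertices_minor:
  assumes "finite D" "D \<subset> verts G"
  shows "minor_step\<^sup>*\<^sup>* G (verts G - D, {e \<in> edges G. e \<inter> D = {}})"
  using assms
proof (induction D rule: finite_induct)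
  case empty
  then show ?case by simp
next
  case (insert v D)
  let ?H = "(verts G - D, {e \<in> edges G. e \<inter> D = {}})"
  have "minor_step\<^sup>*\<^sup>* G ?H" using insert by blast
  moreover have "minor_step ?H (delete_vertex ?H v)"
    by (rule minor_step.del_vertex) (use insert in auto)
  moreover have "delete_vertex ?H v
      = (verts G - insert v D, {e \<in> edges G. e \<inter> insert v D = {}})"
    unfolding delete_vertex_def by auto
  ultimately show ?case by (metis (no_types, lifting) rtranclp.rtrancl_into_rtrancl)
qed

text \<open>Connectedness of \<open>T\<close>, recorded as an order in which its vertices can be
  merged into the root along one edge at a time.\<close>

inductive grown :: "'a ugraph \<Rightarrow> 'a \<Rightarrow> 'a set \<Rightarrow> bool" for G x where
  grown_base: "grown G x {x}"
| grown_insert: "grown G x T \<Longrightarrow> u \<in> T \<Longrightarrow> w \<notin> T \<Longrightarrow> {u, w} \<in> edges G \<Longrightarrow> grown G x (insert w T)"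

definition collapse :: "'a set \<Rightarrow> 'a \<Rightarrow> 'a \<Rightarrow> 'a" where
  "collapse T x w = (if w \<in> T then x else w)"

text \<open>Edges are lost in two ways: those inside \<open>T\<close> would become loops, and edges
  that become parallel merge in the image.\<close>

definition contract_set :: "'a ugraph \<Rightarrow> 'a \<Rightarrow> 'a set \<Rightarrow> 'a ugraph" where
  "contract_set G x T =
     (verts G - (T - {x}), image (collapse T x) ` {e \<in> edges G. \<not> e \<subseteq> T})"

lemma grown_root: "grown G x T \<Longrightarrow> x \<in> T"
  by (induction rule: grown.induct) auto

lemma contract_set_minor:
  assumes "fin_sgraph G" "grown G x T"
  shows "minor_step\<^sup>*\<^sup>* G (contract_set G x T)"
  using assms(2)
proof (induction rule: grown.induct)
  case grown_base
  have "collapse {x} x = id" by (auto simp: collapse_def)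
  moreover have "\<not> e \<subseteq> {x}" if "e \<in> edges G" for e
    using assms(1) that card_mono[of "{x}" e] by (auto simp: fin_sgraph_def)
  then have "{e \<in> edges G. \<not> e \<subseteq> {x}} = edges G" by blast
  ultimately have "contract_set G x {x} = G" by (simp add: contract_set_def)
  then show ?case by simp
next
  case (grown_insert T u w)
  let ?f = "collapse T x" and ?g = "\<lambda>z. if z = w then x else z"
  let ?H = "contract_set G x T"
  have xT: "x \<in> T" using grown_insert.hyps(1) by (rule grown_root)
  then have xw: "x \<noteq> w" using grown_insert.hyps by blast
  have fuw: "?f ` {u, w} = {x, w}" using grown_insert.hyps by (auto simp: collapse_def)
  have xwE: "{x, w} \<in> edges ?H"
    unfolding contract_set_def using grown_insert.hyps fuw by (auto intro!: rev_image_eqI[of "{u, w}"])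
  have comp: "?g ` ?f ` e = collapse (insert w T) x ` e" for e
    unfolding image_image by (rule image_cong) (auto simp: collapse_def)
  \<comment> \<open>Among the edges still present, those that collapse onto the contracted edge are
    the ones joining \<open>w\<close> to \<open>T\<close>.\<close>
  have iff: "?f ` e = {x, w} \<longleftrightarrow> e \<subseteq> insert w T" if e: "e \<in> edges G" "\<not> e \<subseteq> T" for e
  proof
    assume eq: "?f ` e = {x, w}"
    show "e \<subseteq> insert w T"
    proof
      fix z assume "z \<in> e"
      then have "?f z \<in> {x, w}" using eq by blast
      then show "z \<in> insert w T" using xT by (auto simp: collapse_def split: if_splits)
    qed
  next
    assume sub: "e \<subseteq> insert w T"
    have c2: "card e = 2" using assms(1) e by (auto simp: fin_sgraph_def)
    then have "e \<noteq> {w}" by auto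
    then obtain a where "a \<in> e" "a \<in> T" using sub e by blast
    moreover have "w \<in> e" using sub e by blast
    ultimately show "?f ` e = {x, w}"
      using sub grown_insert.hyps(3) by (auto simp: collapse_def)
  qed
  have "{e \<in> edges G. \<not> e \<subseteq> insert w T} = {e \<in> edges G. \<not> e \<subseteq> T} - {e. ?f ` e = {x, w}}"
    using iff by auto
  then have "edges ?H - {{x, w}} = image ?f ` {e \<in> edges G. \<not> e \<subseteq> insert w T}"
    unfolding contract_set_def snd_conv by auto
  then have "image ?g ` (edges ?H - {{x, w}})
      = image (collapse (insert w T) x) ` {e \<in> edges G. \<not> e \<subseteq> insert w T}"
    by (simp only: image_image[of "image ?g" "image ?f"] comp)
  moreover have "verts ?H - {w} = verts G - (insert w T - {x})"
    using xw by (auto simp: contract_set_def)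
  ultimately have "contract_edge ?H x w = contract_set G x (insert w T)"
    unfolding contract_edge_def by (simp only: contract_set_def)
  then have "minor_step ?H (contract_set G x (insert w T))"
    using minor_step.contract[OF xwE xw] by simp
  then show ?case using grown_insert.IH by simp
qed

lemma grown_subset:
  assumes "fin_sgraph G" "grown G x T" "x \<in> verts G"
  shows "T \<subseteq> verts G"
  using assms(2,3) by (induction rule: grown.induct) (use assms(1) in \<open>auto simp: fin_sgraph_def\<close>)

section \<open>Critical graphs\<close>

text \<open>The threshold is kept apart from the density of \<open>G\<close>, so that a smallest
  graph of density at least \<rho> qualifies. Minors are taken literally on the vertices of
  \<open>G\<close>, hence \<open>H \<noteq> G\<close> expresses properness.\<close>

definition critical :: "real \<Rightarrow> 'a ugraph \<Rightarrow> bool" where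
  "critical \<rho> G \<longleftrightarrow> fin_sgraph G \<and> edge_density G \<ge> \<rho> \<and>
     (\<forall>H. minor_step\<^sup>*\<^sup>* G H \<and> H \<noteq> G \<longrightarrow> edge_density H < \<rho>)"

definition inner_edges :: "'a ugraph \<Rightarrow> 'a set \<Rightarrow> 'a set set" where
  "inner_edges G S = {e \<in> edges G. e \<subseteq> S}"

lemma finite_inner_edges: "fin_sgraph G \<Longrightarrow> finite (inner_edges G S)"
  by (simp add: inner_edges_def finite_edges)

lemma critical_edges:
  fixes \<rho> :: real
  assumes "critical \<rho> G"
  shows "\<rho> * card (verts G) \<le> card (edges G)"
proof -
  have "card (verts G) > 0" using assms by (auto simp: critical_def fin_sgraph_def card_gt_0_iff)
  then show ?thesis using assms by (simp add: critical_def edge_density_def field_simps)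
qed

lemma critical_minor_edges:
  fixes \<rho> :: real
  assumes "critical \<rho> G" "minor_step\<^sup>*\<^sup>* G H" "verts H \<noteq> verts G"
  shows "card (edges H) < \<rho> * card (verts H)"
proof -
  have "minor_of H G" using assms(2) graph_iso_refl unfolding minor_of_def by blast
  then have "fin_sgraph H" using assms(1) fin_sgraph_minor unfolding critical_def by blast
  then have "card (verts H) > 0" by (auto simp: fin_sgraph_def card_gt_0_iff)
  moreover have "edge_density H < \<rho>" using assms unfolding critical_def by metis
  ultimately show ?thesis by (simp add: edge_density_def field_simps)
qed

text \<open>With no edge leaving \<open>S\<close>, the parts on \<open>S\<close> and on its
  complement are proper minors that together hold all edges. Each has fewer than \<rho> edges per
  vertex, so \<open>G\<close> would too.\<close>

lemma critical_connected:
  assumes "critical \<rho> G" "S \<subset> verts G" "S \<noteq> {}"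
  obtains x y where "x \<in> S" "y \<in> verts G - S" "{x, y} \<in> edges G"
proof (rule ccontr)
  assume "\<not> thesis"
  then have no: "\<And>x y. x \<in> S \<Longrightarrow> y \<in> verts G - S \<Longrightarrow> {x, y} \<notin> edges G" using that by blast
  have G: "fin_sgraph G" and finV: "finite (verts G)"
    using assms(1) by (auto simp: critical_def fin_sgraph_def)
  let ?R = "verts G - S"
  have "e \<inter> S = {} \<or> e \<inter> ?R = {}" if e: "e \<in> edges G" for e
  proof (rule ccontr)
    assume "\<not> ?thesis"
    then obtain x y where xy: "x \<in> e" "x \<in> S" "y \<in> e" "y \<in> ?R" by blast
    have "card e = 2" using G e by (auto simp: fin_sgraph_def)
    then have "e = {x, y}" using xy by (auto simp: card_2_iff)
    then show False using no[OF xy(2,4)] e by blast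
  qed
  then have "edges G = {e \<in> edges G. e \<inter> S = {}} \<union> {e \<in> edges G. e \<inter> ?R = {}}" by blast
  then have "card (edges G) \<le> card {e \<in> edges G. e \<inter> S = {}} + card {e \<in> edges G. e \<inter> ?R = {}}"
    using card_Un_le[of "{e \<in> edges G. e \<inter> S = {}}" "{e \<in> edges G. e \<inter> ?R = {}}"] by argo
  moreover have "card {e \<in> edges G. e \<inter> S = {}} < \<rho> * card (verts G - S)"
    using critical_minor_edges[OF assms(1) delete_vertices_minor[of S]] assms finV
    by (auto intro: finite_subset)
  moreover have "card {e \<in> edges G. e \<inter> ?R = {}} < \<rho> * card S"
  proof -
    have "verts G - ?R = S" using assms(2) by blast
    then show ?thesis
      using critical_minor_edges[OF assms(1) delete_vertices_minor[of ?R]] assms finV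
      by (auto intro: finite_subset)
  qed
  moreover have "card (verts G) = card S + card (verts G - S)"
    using assms(2) finV by (metis card_Diff_subset card_mono finite_subset le_add_diff_inverse psubset_imp_subset)
  then have "\<rho> * card (verts G) = \<rho> * card S + \<rho> * card (verts G - S)"
    by (simp add: algebra_simps)
  ultimately show False using critical_edges[OF assms(1)] by linarith
qed

text \<open>Contracting \<open>T\<close> must destroy at least \<open>2j\<close> edges, since \<open>j/(k-1) \<le> 1\<close>; these are edges
  inside \<open>T\<close>, unless some outside vertex sends two edges to \<open>T\<close>.\<close>

lemma critical_two_neighbours:
  fixes k j :: nat
  assumes "critical \<rho> G" "\<rho> > 2 - 1 / (real k - 1)" "grown G x T" "x \<in> verts G"
    and "card T = j + 1" "1 \<le> j" "j < k" "card (inner_edges G T) < 2 * j"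
  obtains w a b where "w \<in> verts G - T" "a \<in> T" "b \<in> T" "a \<noteq> b"
    "{a, w} \<in> edges G" "{b, w} \<in> edges G"
proof (rule ccontr)
  assume "\<not> thesis"
  then have no: "\<And>w a b. \<lbrakk>w \<in> verts G - T; a \<in> T; b \<in> T; {a, w} \<in> edges G; {b, w} \<in> edges G\<rbrakk>
      \<Longrightarrow> a = b" using that by blast
  have G: "fin_sgraph G" using assms(1) by (simp add: critical_def)
  have xT: "x \<in> T" using assms(3) by (rule grown_root)
  have TV: "T \<subseteq> verts G" by (rule grown_subset[OF G assms(3,4)])
  have finV: "finite (verts G)" using G by (simp add: fin_sgraph_def)
  let ?H = "contract_set G x T" and ?f = "collapse T x"
  let ?O = "{e \<in> edges G. \<not> e \<subseteq> T}"
  \<comment> \<open>Two outer edges merge only if they join one outside vertex to different vertices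
    of \<open>T\<close>, which is excluded here. So only inner edges are lost.\<close>
  have "inj_on (image ?f) ?O"
  proof (rule inj_onI)
    fix e e' assume e: "e \<in> ?O" "e' \<in> ?O" and eq: "?f ` e = ?f ` e'"
    have pair: "\<exists>p q. d = {p, q} \<and> p \<noteq> q \<and> q \<notin> T \<and> q \<in> verts G" if "d \<in> ?O" for d
    proof -
      have "card d = 2" "d \<subseteq> verts G" using that G by (auto simp: fin_sgraph_def)
      then show ?thesis using that unfolding card_2_iff by (auto simp: insert_commute)
    qed
    obtain p q where pq: "e = {p, q}" "p \<noteq> q" "q \<notin> T" "q \<in> verts G" using pair[OF e(1)] by blast
    obtain r s where rs: "e' = {r, s}" "r \<noteq> s" "s \<notin> T" "s \<in> verts G" using pair[OF e(2)] by blast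
    have eq': "{?f p, q} = {?f r, s}" 
      using eq pq(3) rs(3) unfolding pq(1) rs(1) image_insert image_empty by (simp add: collapse_def)
    show "e = e'"
    proof (cases "p \<in> T")
      case True
      then have "{x, q} = {?f r, s}" using eq' by (simp add: collapse_def)
      moreover have "s \<noteq> x" "q \<noteq> x" using rs pq xT by auto
      ultimately have qs: "q = s" "?f r = x" by (auto simp: doubleton_eq_iff)
      then have "r \<in> T" using xT by (auto simp: collapse_def split: if_splits)
      then have "p = r" using no[of q p r] True pq rs e qs by blast
      then show ?thesis using qs pq rs by simp
    next
      case False
      then have eq2: "{p, q} = {?f r, s}" using eq' by (simp add: collapse_def)
      then have "r \<notin> T" using False pq xT by (auto simp: collapse_def doubleton_eq_iff)
      then show ?thesis using eq2 pq rs by (simp add: collapse_def)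
    qed
  qed
  then have cH: "card (edges ?H) = card ?O" by (simp add: contract_set_def card_image)
  have "edges G = inner_edges G T \<union> ?O" by (auto simp: inner_edges_def)
  then have "card (edges G) \<le> card (inner_edges G T) + card ?O"
    using card_Un_le[of "inner_edges G T" ?O] by argo
  then have lost: "real (card (edges G)) \<le> 2 * real j - 1 + card (edges ?H)"
    using cH assms(8) by linarith
  have finT: "finite T" using TV finV by (rule finite_subset)
  have "card (T - {x}) = j" using xT assms(5) finT by simp
  then have vH: "card (verts ?H) = card (verts G) - j" "j \<le> card (verts G)"
    using TV finT card_mono[OF finV, of "T - {x}"] card_Diff_subset[of "T - {x}" "verts G"]
    by (auto simp: contract_set_def)
  have "verts ?H \<noteq> verts G"
    using vH assms(6) by (metis diff_is_0_eq diff_less less_irrefl less_le_trans less_one not_le)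
  then have "card (edges ?H) < \<rho> * card (verts ?H)"
    using critical_minor_edges[OF assms(1) contract_set_minor[OF G assms(3)]] by blast
  also have "\<dots> = \<rho> * card (verts G) - \<rho> * j"
    using vH by (simp add: of_nat_diff algebra_simps)
  \<comment> \<open>The contraction removes \<open>j\<close> vertices, so criticality forces a loss
    of more than \<open>\<rho> * j\<close> edges.\<close>
  finally have "\<rho> * j < 2 * real j - 1"
    using lost critical_edges[OF assms(1)] by linarith
  moreover have "2 * real j - 1 \<le> (2 - 1 / (real k - 1)) * j"
  proof -
    have "real j / (real k - 1) \<le> 1" using assms(6,7) by (simp add: divide_le_eq)
    then show ?thesis by (simp add: algebra_simps)
  qed
  moreover have "(2 - 1 / (real k - 1)) * j \<le> \<rho> * j"
    using assms(2) by (intro mult_right_mono) auto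
  ultimately show False by linarith
qed

lemma inner_edges_Un:
  assumes "fin_sgraph G" "S \<inter> T = {x}"
  shows "card (inner_edges G S) + card (inner_edges G T) \<le> card (inner_edges G (S \<union> T))"
    and "\<lbrakk>e \<in> edges G; e \<subseteq> S \<union> T; \<not> e \<subseteq> S; \<not> e \<subseteq> T\<rbrakk> \<Longrightarrow>
      card (inner_edges G S) + card (inner_edges G T) + 1 \<le> card (inner_edges G (S \<union> T))"
proof -
  have "\<not> e \<subseteq> {x}" if "e \<in> edges G" for e
    using assms(1) that card_mono[of "{x}" e] by (auto simp: fin_sgraph_def)
  then have "inner_edges G S \<inter> inner_edges G T = {}"
    using assms(2) by (auto simp: inner_edges_def)
  then have eq: "card (inner_edges G S \<union> inner_edges G T)
      = card (inner_edges G S) + card (inner_edges G T)"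
    using finite_inner_edges[OF assms(1)] by (intro card_Un_disjoint) auto
  have sub: "inner_edges G S \<union> inner_edges G T \<subseteq> inner_edges G (S \<union> T)"
    by (auto simp: inner_edges_def)
  then show "card (inner_edges G S) + card (inner_edges G T) \<le> card (inner_edges G (S \<union> T))"
    using eq finite_inner_edges[OF assms(1)] by (metis card_mono)
  assume e: "e \<in> edges G" "e \<subseteq> S \<union> T" "\<not> e \<subseteq> S" "\<not> e \<subseteq> T"
  then have "inner_edges G S \<union> inner_edges G T \<subset> inner_edges G (S \<union> T)"
    using sub by (auto simp: inner_edges_def)
  then show "card (inner_edges G S) + card (inner_edges G T) + 1 \<le> card (inner_edges G (S \<union> T))"
    using eq psubset_card_mono[OF finite_inner_edges[OF assms(1)]] by (metis Suc_eq_plus1 Suc_leI)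
qed

text \<open>Extremal choice: a largest vertex set satisfying the inequality within itself must be
  everything, since otherwise a connected set grown out of one of its vertices could be added to
  it.\<close>

lemma critical_edge_bound:
  fixes k :: nat
  assumes "critical \<rho> G" "\<rho> > 2 - 1 / (real k - 1)" "k \<ge> 2"
  shows "(2 * real k - 1) * (real (card (verts G)) - 1) \<le> real k * card (edges G)"
proof -
  have G: "fin_sgraph G" and finV: "finite (verts G)" and neV: "verts G \<noteq> {}"
    using assms(1) by (auto simp: critical_def fin_sgraph_def)
  \<comment> \<open>The bound localised to \<open>S\<close>; its left side is 0 for a
    singleton.\<close>
  define P where "P S \<longleftrightarrow> S \<subseteq> verts G \<and> S \<noteq> {} \<and>
    (2 * real k - 1) * (real (card S) - 1) \<le> real k * card (inner_edges G S)" for S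
  obtain v where v: "v \<in> verts G" using neV by blast
  then have "P {v}" by (simp add: P_def)
  then obtain S where S: "P S" and max: "\<And>S'. P S' \<Longrightarrow> card S' \<le> card S"
    using ex_has_greatest_nat[of P "{v}" card "card (verts G) + 1"] finV
    by (metis P_def card_mono less_Suc_eq_le Suc_eq_plus1)
  have SV: "S \<subseteq> verts G" "S \<noteq> {}" and finS: "finite S"
    using S finV by (auto simp: P_def intro: finite_subset)
  have "S = verts G"
  proof (rule ccontr)
    assume "S \<noteq> verts G"
    then obtain x y where xy: "x \<in> S" "y \<in> verts G - S" "{x, y} \<in> edges G"
      using critical_connected[OF assms(1), of S] SV by blast
    \<comment> \<open>By maximality, no set hanging off \<open>S\<close> at \<open>x\<close> brings
      \<open>j\<close> new vertices with at least (2 - 1/k)j new edges.\<close>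
    have no_ext: False
      if T: "T \<subseteq> verts G" "S \<inter> T = {x}" "card T = j + 1" "1 \<le> j"
        and gain: "card (inner_edges G S) + g \<le> card (inner_edges G (S \<union> T))"
          "(2 * real k - 1) * j \<le> real k * g"
      for T j g
    proof -
      have finT: "finite T" using T finV by (auto intro: finite_subset)
      have cST: "card (S \<union> T) = card S + j"
        using card_Un_Int[OF finS finT] T by simp
      have "real k * (card (inner_edges G S) + g) \<le> real k * card (inner_edges G (S \<union> T))"
        using gain(1) by (intro mult_left_mono) auto
      then have "P (S \<union> T)"
        using S T SV gain(2) unfolding P_def cST by (auto simp: algebra_simps)
      then show False using max[of "S \<union> T"] cST T(4) by simp
    qed
    \<comment> \<open>Invariant of the growth: \<open>T\<close> touches \<open>S\<close> only at
      \<open>x\<close>, and its \<open>j\<close> new vertices carry at least 2j - 1 edges.\<close>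
    have "\<exists>T. grown G x T \<and> S \<inter> T = {x} \<and> card T = j + 1 \<and> 2 * j \<le> card (inner_edges G T) + 1"
      if "1 \<le> j" "j \<le> k" for j
      using that
    proof (induction j rule: nat_induct_at_least)
      case base
      have "grown G x {y, x}" by (rule grown_insert[OF grown_base, of x]) (use xy in auto)
      moreover have "{x, y} \<in> inner_edges G {y, x}" using xy by (auto simp: inner_edges_def)
      then have "1 \<le> card (inner_edges G {y, x})"
        using finite_inner_edges[OF G] by (metis One_nat_def Suc_leI card_gt_0_iff empty_iff)
      moreover have "x \<noteq> y" using xy by auto
      ultimately show ?case using xy by (intro exI[of _ "{y, x}"]) auto
    next
      case (Suc j)
      then obtain T where T: "grown G x T" "S \<inter> T = {x}" "card T = j + 1"
        "2 * j \<le> card (inner_edges G T) + 1" by auto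
      have xV: "x \<in> verts G" using xy SV by blast
      have TV: "T \<subseteq> verts G" using grown_subset[OF G T(1) xV] .
      have finT: "finite T" using TV finV by (rule finite_subset)
      have gain: "(2 * real k - 1) * j \<le> real k * (2 * j)" by (simp add: algebra_simps)
      \<comment> \<open>With 2j edges, \<open>T\<close> itself would be a forbidden extension, since
        2 exceeds 2 - 1/k.\<close>
      have lt: "card (inner_edges G T) < 2 * j"
      proof (rule ccontr)
        assume "\<not> ?thesis"
        then have "card (inner_edges G S) + 2 * j \<le> card (inner_edges G (S \<union> T))"
          using inner_edges_Un(1)[OF G T(2)] by linarith
        then show False using no_ext[OF TV T(2,3) Suc.hyps, of "2 * j"] gain by simp
      qed
      obtain w a b where w: "w \<in> verts G - T" "a \<in> T" "b \<in> T" "a \<noteq> b"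
        "{a, w} \<in> edges G" "{b, w} \<in> edges G"
        using critical_two_neighbours[OF assms(1,2) T(1) xV T(3) Suc.hyps _ lt] Suc.prems by auto
      \<comment> \<open>If \<open>w\<close> were in \<open>S\<close>, one of its two neighbours in
        \<open>T\<close> would differ from \<open>x\<close> and hence lie outside \<open>S\<close>;
        that crossing edge raises the gain from 2j - 1 to 2j.\<close>
      have wS: "w \<notin> S"
      proof
        assume "w \<in> S"
        have "\<exists>c \<in> T. c \<noteq> x \<and> {c, w} \<in> edges G" using w by metis
        then obtain c where c: "c \<in> T" "c \<noteq> x" "{c, w} \<in> edges G" by blast
        then have "c \<notin> S" using T(2) by blast
        then have "card (inner_edges G S) + 2 * j \<le> card (inner_edges G (S \<union> T))"
          using inner_edges_Un(2)[OF G T(2) c(3)] c w(1) \<open>w \<in> S\<close> T(4) by auto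
        then show False using no_ext[OF TV T(2,3) Suc.hyps, of "2 * j"] gain by simp
      qed
      have "inner_edges G T \<union> {{a, w}, {b, w}} \<subseteq> inner_edges G (insert w T)"
        using w by (auto simp: inner_edges_def)
      then have "card (inner_edges G T \<union> {{a, w}, {b, w}}) \<le> card (inner_edges G (insert w T))"
        using finite_inner_edges[OF G] by (metis card_mono)
      moreover have "card (inner_edges G T \<union> {{a, w}, {b, w}}) = card (inner_edges G T) + 2"
      proof -
        have "{a, w} \<noteq> {b, w}" using w by (auto simp: doubleton_eq_iff)
        moreover have "inner_edges G T \<inter> {{a, w}, {b, w}} = {}"
          using w by (auto simp: inner_edges_def)
        ultimately show ?thesis
          using finite_inner_edges[OF G, of T] by (subst card_Un_disjoint) auto
      qed
      moreover have "grown G x (insert w T)"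
        using grown_insert[OF T(1) w(2) _ w(5)] w(1) by blast
      moreover have "card (insert w T) = Suc j + 1" using w(1) finT T(3) by simp
      moreover have "S \<inter> insert w T = {x}" using T(2) wS by blast
      ultimately show ?case using T(4) by (intro exI[of _ "insert w T"]) auto
    qed
    \<comment> \<open>At j = k the guaranteed 2k - 1 edges meet the ratio 2 - 1/k exactly.\<close>
    from this[of k] obtain T where T: "grown G x T" "S \<inter> T = {x}" "card T = k + 1"
      "2 * k \<le> card (inner_edges G T) + 1" using assms(3) by auto
    have TV: "T \<subseteq> verts G" using grown_subset[OF G T(1)] xy SV by blast
    have "card (inner_edges G S) + (2 * k - 1) \<le> card (inner_edges G (S \<union> T))"
      using inner_edges_Un(1)[OF G T(2)] T(4) by linarith
    moreover have "(2 * real k - 1) * k \<le> real k * real (2 * k - 1)"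
      using assms(3) by (simp add: of_nat_diff)
    ultimately show False using no_ext[OF TV T(2,3), of "2 * k - 1"] assms(3) by simp
  qed
  moreover have "inner_edges G (verts G) = edges G"
    using G by (auto simp: inner_edges_def fin_sgraph_def)
  ultimately show ?thesis using S by (simp add: P_def)
qed

text \<open>Every minor step strictly lowers the number of vertices plus edges, so a minimiser among
  the members of density at least \<rho> works.\<close>

lemma critical_exists:
  assumes "graph_class A" "minor_closed A" "G \<in> A" "edge_density G \<ge> \<rho>"
  obtains H where "H \<in> A" "critical \<rho> H"
proof -
  let ?Q = "\<lambda>H. H \<in> A \<and> edge_density H \<ge> \<rho>"
  let ?\<mu> = "\<lambda>H :: nat ugraph. card (verts H) + card (edges H)"
  obtain H where H: "?Q H" and min: "\<And>H'. ?Q H' \<Longrightarrow> ?\<mu> H \<le> ?\<mu> H'"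
    using ex_has_least_nat[of ?Q G ?\<mu>] assms(3,4) by blast
  have fin: "fin_sgraph H" if "H \<in> A" for H using assms(1) that by (simp add: graph_class_def)
  have closed: "H'' \<in> A" if "H' \<in> A" "minor_step\<^sup>*\<^sup>* H' H''" for H' H''
    using assms(2) that graph_iso_refl unfolding minor_closed_def minor_of_def by blast
  have less: "?\<mu> H'' < ?\<mu> H'" if "fin_sgraph H'" "minor_step H' H''" for H' H'' :: "nat ugraph"
    using that(2)
  proof cases
    case (del_vertex v)
    have "card (verts H'') < card (verts H')"
      using del_vertex that(1) card_Diff1_less[of "verts H'" v]
      by (simp add: delete_vertex_def fin_sgraph_def)
    moreover have "card (edges H'') \<le> card (edges H')"
      using del_vertex finite_edges[OF that(1)] by (auto simp: delete_vertex_def intro: card_mono)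
    ultimately show ?thesis by simp
  next
    case (del_edge e)
    then show ?thesis using card_Diff1_less[OF finite_edges[OF that(1)], of e]
      by (simp add: delete_edge_def)
  next
    case (contract u v)
    have "v \<in> verts H'" using contract that(1) by (auto simp: fin_sgraph_def)
    then have "card (verts H'') < card (verts H')"
      using contract that(1) card_Diff1_less[of "verts H'" v]
      by (simp add: contract_edge_def fin_sgraph_def)
    moreover have "card (edges H'') \<le> card (edges H')"
      using contract finite_edges[OF that(1)] unfolding contract_edge_def
      by (auto intro: order_trans[OF card_image_le card_mono])
    ultimately show ?thesis by simp
  qed
  have le: "fin_sgraph H'' \<and> ?\<mu> H'' \<le> ?\<mu> H'" if "minor_step\<^sup>*\<^sup>* H' H''" "fin_sgraph H'" for H' H''
    using that
  proof (induction rule: rtranclp_induct)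
    case (step y z)
    then show ?case using less[of y z] fin_sgraph_minor_step[of y z] by auto
  qed simp
  have "edge_density H' < \<rho>" if "minor_step\<^sup>*\<^sup>* H H'" "H' \<noteq> H" for H'
  proof (rule ccontr)
    assume "\<not> ?thesis"
    then have "?\<mu> H \<le> ?\<mu> H'" using min closed[OF conjunct1[OF H] that(1)] by simp
    moreover obtain K where K: "minor_step H K" "minor_step\<^sup>*\<^sup>* K H'"
      using \<open>minor_step\<^sup>*\<^sup>* H H'\<close> \<open>H' \<noteq> H\<close> by (blast elim: converse_rtranclpE)
    then have "?\<mu> H' < ?\<mu> H"
      using less[of H K] le[OF K(2)] fin_sgraph_minor_step[of H K] fin[of H] H by auto
    ultimately show False by simp
  qed
  then have "critical \<rho> H" using H fin by (auto simp: critical_def)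
  then show ?thesis using that H by blast
qed

section \<open>Subgraphs of a fan over disjoint paths\<close>

definition in_between :: "('a \<Rightarrow> nat) \<Rightarrow> 'a \<Rightarrow> 'a \<Rightarrow> 'a \<Rightarrow> bool" where
  "in_between pos x y z \<longleftrightarrow> (pos x < pos z \<and> pos z < pos y) \<or> (pos y < pos z \<and> pos z < pos x)"

text \<open>A subgraph of a hub \<open>r\<close> joined to \<open>m\<close> disjoint paths: \<open>col\<close> numbers the paths, \<open>pos\<close> is
  the order along them, and the path numbered \<open>c\<close> has at most \<open>cap c\<close> vertices. Removing any
  vertex from a path and closing the gap again gives a fan, so this is a minor-closed property.\<close>

definition fan_on ::
    "(nat \<Rightarrow> nat) \<Rightarrow> nat \<Rightarrow> ('a \<Rightarrow> nat) \<Rightarrow> ('a \<Rightarrow> nat) \<Rightarrow> 'a \<Rightarrow> 'a ugraph \<Rightarrow> bool" where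
  "fan_on cap m col pos r G \<longleftrightarrow> fin_sgraph G \<and> r \<in> verts G \<and> inj_on pos (verts G - {r}) \<and>
     col ` (verts G - {r}) \<subseteq> {..<m} \<and>
     (\<forall>c<m. card {x \<in> verts G - {r}. col x = c} \<le> cap c) \<and>
     (\<forall>x y. {x, y} \<in> edges G \<and> x \<noteq> r \<and> y \<noteq> r \<longrightarrow>
        col x = col y \<and> \<not> (\<exists>z \<in> verts G - {r}. col z = col x \<and> in_between pos x y z))"

text \<open>The hub may move from \<open>r\<close> to \<open>s\<close>. Capacities and injectivity
  survive because the non-hub vertices only shrink, which leaves the condition on path edges to
  recheck.\<close>

lemma fan_on_mono:
  assumes "fan_on cap m col pos r G" "fin_sgraph H" "s \<in> verts H"
    and sub: "verts H - {s} \<subseteq> verts G - {r}"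
    and E: "\<And>x y. {x, y} \<in> edges H \<Longrightarrow> x \<noteq> s \<Longrightarrow> y \<noteq> s \<Longrightarrow>
        col x = col y \<and> \<not> (\<exists>z \<in> verts H - {s}. col z = col x \<and> in_between pos x y z)"
  shows "fan_on cap m col pos s H"
proof -
  have "card {x \<in> verts H - {s}. col x = c} \<le> cap c" if "c < m" for c
  proof -
    have "card {x \<in> verts H - {s}. col x = c} \<le> card {x \<in> verts G - {r}. col x = c}"
      using assms(1) sub by (intro card_mono) (auto simp: fan_on_def fin_sgraph_def)
    also have "\<dots> \<le> cap c" using assms(1) that by (simp add: fan_on_def)
    finally show ?thesis .
  qed
  moreover have "inj_on pos (verts H - {s})"
    using assms(1) sub by (auto simp: fan_on_def intro: inj_on_subset)
  moreover have "col ` (verts H - {s}) \<subseteq> {..<m}"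
    using assms(1) sub unfolding fan_on_def by blast
  ultimately show ?thesis using assms(2,3) E unfolding fan_on_def by blast
qed

lemma fan_on_subgraph:
  assumes "fan_on cap m col pos r G" "fin_sgraph H" "s \<in> verts H"
    and sub: "verts H - {s} \<subseteq> verts G - {r}"
    and E: "\<And>x y. {x, y} \<in> edges H \<Longrightarrow> x \<noteq> s \<Longrightarrow> y \<noteq> s \<Longrightarrow> {x, y} \<in> edges G"
  shows "fan_on cap m col pos s H"
proof (rule fan_on_mono[OF assms(1-4)])
  fix x y assume xy: "{x, y} \<in> edges H" "x \<noteq> s" "y \<noteq> s"
  then have "{x, y} \<subseteq> verts H" using assms(2) by (auto simp: fin_sgraph_def)
  then have "x \<noteq> r" "y \<noteq> r" using xy sub by auto
  then show "col x = col y \<and> \<not> (\<exists>z \<in> verts H - {s}. col z = col x \<and> in_between pos x y z)"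
    using assms(1) E[OF xy] sub unfolding fan_on_def by blast
qed

text \<open>Contracting a hub edge absorbs a path vertex into the hub, which is called
  \<open>u\<close> afterwards even if it was \<open>v\<close>. Contracting a path edge closes the
  gap left by \<open>v\<close>.\<close>

lemma fan_on_contract:
  assumes fan: "fan_on cap m col pos r G" and uv: "{u, v} \<in> edges G" "u \<noteq> v"
    and H: "H = contract_edge G u v"
  shows "\<exists>s. fan_on cap m col pos s H"
proof -
  let ?g = "\<lambda>w. if w = v then u else w"
  have G: "fin_sgraph G" and r: "r \<in> verts G" using fan by (auto simp: fan_on_def)
  have finH: "fin_sgraph H"
    unfolding H by (rule fin_sgraph_minor_step[OF G minor_step.contract[OF uv]])
  have uvV: "u \<in> verts G" "v \<in> verts G" using G uv by (auto simp: fin_sgraph_def)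
  have vH: "verts H = verts G - {v}" by (simp add: H contract_edge_def)
  \<comment> \<open>An edge of \<open>H\<close> is an edge of \<open>G\<close> away from
    \<open>v\<close>, or an edge at \<open>v\<close> moved to \<open>u\<close>.\<close>
  have edge: "{x, y} \<in> edges G \<and> x \<noteq> v \<and> y \<noteq> v \<or> x = u \<and> {v, y} \<in> edges G \<or> y = u \<and> {v, x} \<in> edges G"
    if xy: "{x, y} \<in> edges H" for x y
  proof -
    obtain e where e: "e \<in> edges G" "?g ` e = {x, y}"
      using xy unfolding H contract_edge_def snd_conv by auto
    have xyv: "x \<noteq> v" "y \<noteq> v" using finH xy vH by (auto simp: fin_sgraph_def)
    have "card e = 2" using G e(1) by (simp add: fin_sgraph_def)
    then obtain a b where ab: "e = {a, b}" "a \<noteq> b" unfolding card_2_iff by blast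
    have "{?g a, ?g b} = {x, y}" using e(2) unfolding ab(1) image_insert image_empty .
    then have "?g a = x \<and> ?g b = y \<or> ?g a = y \<and> ?g b = x" by (simp add: doubleton_eq_iff)
    then show ?thesis
      using e(1) ab xyv by (cases "a = v"; cases "b = v") (auto simp: insert_commute)
  qed
  consider "v = r" | "u = r" | "u \<noteq> r" "v \<noteq> r" by blast
  then show ?thesis
  proof cases
    case 1
    have "fan_on cap m col pos u H"
      by (rule fan_on_subgraph[OF fan finH]) (use uvV uv vH edge 1 in auto)
    then show ?thesis by blast
  next
    case 2
    have "fan_on cap m col pos r H"
      by (rule fan_on_subgraph[OF fan finH]) (use r uv vH edge 2 in auto)
    then show ?thesis by blast
  next
    case 3
    have inj: "inj_on pos (verts G - {r})"
      and adj: "\<And>x y. {x, y} \<in> edges G \<Longrightarrow> x \<noteq> r \<Longrightarrow> y \<noteq> r \<Longrightarrow> col x = col y"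
      and gap: "\<And>x y z. {x, y} \<in> edges G \<Longrightarrow> x \<noteq> r \<Longrightarrow> y \<noteq> r \<Longrightarrow>
          z \<in> verts G - {r} \<Longrightarrow> col z = col x \<Longrightarrow> \<not> in_between pos x y z"
      using fan unfolding fan_on_def by blast+
    have neq: "pos x \<noteq> pos y" if "x \<in> verts G - {r}" "y \<in> verts G - {r}" "x \<noteq> y" for x y
      using inj that by (meson inj_on_contraD)
    have new: "col u = col w \<and> \<not> (\<exists>z \<in> verts H - {r}. col z = col u \<and> in_between pos u w z)"
      if w: "{v, w} \<in> edges G" "w \<noteq> r" "w \<noteq> u" for w
    proof -
      have wV: "w \<in> verts G" "w \<noteq> v" using G w by (auto simp: fin_sgraph_def)
      have cw: "col u = col v" "col v = col w" using adj[OF uv(1)] adj[OF w(1)] 3 w by auto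
      \<comment> \<open>As \<open>w\<close> is not between \<open>u\<close> and \<open>v\<close>,
        nor \<open>u\<close> between \<open>v\<close> and \<open>w\<close>, the two lie on opposite
        sides of \<open>v\<close>. Any other vertex of the path between them would fall into one of
        two empty gaps.\<close>
      have g1: "\<not> in_between pos u v w" using gap[OF uv(1)] 3 w wV cw by simp
      have g2: "\<not> in_between pos v w u" using gap[OF w(1)] 3 w uvV cw by simp
      have p: "pos u \<noteq> pos v" "pos v \<noteq> pos w" "pos u \<noteq> pos w" using neq 3 w uvV wV uv by auto
      have "\<not> in_between pos u w z" if z: "z \<in> verts H - {r}" "col z = col u" for z
      proof -
        have zV: "z \<in> verts G - {r}" "z \<noteq> v" using z vH by auto
        have "\<not> in_between pos u v z" using gap[OF uv(1)] 3 zV z by simp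
        moreover have "\<not> in_between pos v w z" using gap[OF w(1)] 3 w zV z cw by simp
        moreover have "pos z \<noteq> pos v" using neq zV uvV 3 by auto
        ultimately show ?thesis using g1 g2 p unfolding in_between_def by linarith
      qed
      then show ?thesis using cw by auto
    qed
    have "fan_on cap m col pos r H"
    proof (rule fan_on_mono[OF fan finH])
      show "r \<in> verts H" "verts H - {r} \<subseteq> verts G - {r}" using r 3 vH by auto
      fix x y assume xy: "{x, y} \<in> edges H" "x \<noteq> r" "y \<noteq> r"
      have "x \<noteq> y" using finH xy by (auto simp: fin_sgraph_def)
      have sym: "in_between pos y x = in_between pos x y" by (auto simp: in_between_def fun_eq_iff)
      from edge[OF xy(1)] consider "{x, y} \<in> edges G" | "x = u" "{v, y} \<in> edges G"
        | "y = u" "{v, x} \<in> edges G" by blast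
      then show "col x = col y \<and> \<not> (\<exists>z \<in> verts H - {r}. col z = col x \<and> in_between pos x y z)"
      proof cases
        case 1
        then show ?thesis using adj[OF 1 xy(2,3)] gap[OF 1 xy(2,3)] vH by auto
      next
        case 2
        then show ?thesis using new[of y] xy \<open>x \<noteq> y\<close> by auto
      next
        case 3
        then show ?thesis using new[of x] xy \<open>x \<noteq> y\<close> sym by auto
      qed
    qed
    then show ?thesis by blast
  qed
qed

lemma fan_on_minor_step:
  assumes "fan_on cap m col pos r G" "minor_step G H"
  shows "\<exists>s. fan_on cap m col pos s H"
  using assms(2)
proof cases
  case (del_vertex v)
  have G: "fin_sgraph G" and r: "r \<in> verts G" using assms(1) by (auto simp: fan_on_def)
  have finH: "fin_sgraph H" by (rule fin_sgraph_minor_step[OF G assms(2)])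
  \<comment> \<open>If the hub is deleted, any surviving vertex can be declared the hub, since edges
    at the hub are unrestricted.\<close>
  obtain s where s: "s \<in> verts G" "s \<noteq> v" "v \<noteq> r \<Longrightarrow> s = r"
    using del_vertex r by (cases "v = r") auto
  have "fan_on cap m col pos s H"
    by (rule fan_on_subgraph[OF assms(1) finH]) (use s del_vertex in \<open>auto simp: delete_vertex_def\<close>)
  then show ?thesis by blast
next
  case (del_edge e)
  have "fan_on cap m col pos r H"
    by (rule fan_on_subgraph[OF assms(1) fin_sgraph_minor_step[OF _ assms(2)]])
      (use del_edge assms(1) in \<open>auto simp: delete_edge_def fan_on_def\<close>)
  then show ?thesis by blast
next
  case (contract u v)
  then show ?thesis using fan_on_contract[OF assms(1)] by blast
qed

text \<open>Apart from the edges at the hub, each edge is charged to its later end, which is never the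
  first vertex of a path.\<close>

lemma fan_on_card_edges:
  assumes "fan_on cap m col pos r G"
  shows "card (edges G) + card (col ` (verts G - {r})) \<le> 2 * card (verts G - {r})"
proof -
  let ?W = "verts G - {r}"
  have G: "fin_sgraph G" and inj: "inj_on pos ?W" using assms by (auto simp: fan_on_def)
  have finW: "finite ?W" using G by (simp add: fin_sgraph_def)
  define first where "first c = arg_min_on pos {x \<in> ?W. col x = c}" for c
  have first: "first (col x) \<in> ?W" "col (first (col x)) = col x" "pos (first (col x)) \<le> pos x"
    if "x \<in> ?W" for x
  proof -
    have fin: "finite {y \<in> ?W. col y = col x}" using finW by simp
    have ne: "{y \<in> ?W. col y = col x} \<noteq> {}" using that by blast
    show "first (col x) \<in> ?W" "col (first (col x)) = col x"
      using arg_min_if_finite(1)[OF fin ne, of pos] unfolding first_def by auto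
    show "pos (first (col x)) \<le> pos x"
      unfolding first_def by (rule arg_min_least[OF fin ne]) (use that in simp)
  qed
  let ?F = "first ` col ` ?W"
  have "inj_on first (col ` ?W)" by (rule inj_on_inverseI[of _ col]) (use first in auto)
  then have cF: "card ?F = card (col ` ?W)" by (rule card_image)
  have FW: "?F \<subseteq> ?W" using first by auto
  let ?hub = "{e \<in> edges G. r \<in> e}" and ?path = "{e \<in> edges G. r \<notin> e}"
  have "?hub \<subseteq> (\<lambda>x. {r, x}) ` ?W"
  proof
    fix e assume e: "e \<in> ?hub"
    then have "card e = 2" "e \<subseteq> verts G" using G by (auto simp: fin_sgraph_def)
    then show "e \<in> (\<lambda>x. {r, x}) ` ?W" using e by (auto simp: card_2_iff)
  qed
  then have hub: "card ?hub \<le> card ?W" by (rule surj_card_le[OF finW])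
  \<comment> \<open>Orients a path edge: \<open>x\<close> is the immediate predecessor of
    \<open>y\<close> within its colour.\<close>
  define Q where "Q e x y \<longleftrightarrow> e = {x, y} \<and> x \<in> ?W \<and> y \<in> ?W \<and> pos x < pos y \<and> col x = col y \<and>
      (\<forall>z \<in> ?W. col z = col y \<longrightarrow> pos z \<le> pos x \<or> pos y \<le> pos z)" for e x y
  have ends: "\<exists>x y. Q e x y" if e: "e \<in> ?path" for e
  proof -
    have "card e = 2" "e \<subseteq> verts G" using G e by (auto simp: fin_sgraph_def)
    then obtain a b where ab: "e = {a, b}" "a \<noteq> b" "a \<in> ?W" "b \<in> ?W"
      using e by (auto simp: card_2_iff)
    then have "pos a \<noteq> pos b" using inj by (meson inj_on_contraD)
    moreover have "col a = col b" "\<forall>z \<in> ?W. col z = col a \<longrightarrow> \<not> in_between pos a b z"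
      using assms e ab unfolding fan_on_def by blast+
    ultimately have ord: "pos a < pos b \<or> pos b < pos a" and col: "col a = col b"
      and gap: "\<And>z. z \<in> ?W \<Longrightarrow> col z = col a \<Longrightarrow> \<not> in_between pos a b z"
      by (linarith, simp, blast)
    from ord show ?thesis
    proof
      assume lt: "pos a < pos b"
      have "\<forall>z \<in> ?W. col z = col b \<longrightarrow> pos z \<le> pos a \<or> pos b \<le> pos z"
        using gap col unfolding in_between_def by (metis not_less)
      then show ?thesis using ab lt col unfolding Q_def by blast
    next
      assume lt: "pos b < pos a"
      have "\<forall>z \<in> ?W. col z = col a \<longrightarrow> pos z \<le> pos b \<or> pos a \<le> pos z"
        using gap unfolding in_between_def by (metis not_less)
      moreover have "e = {b, a}" using ab(1) by blast
      ultimately show ?thesis using ab lt col unfolding Q_def by metis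
    qed
  qed
  define lo where "lo e = (SOME x. \<exists>y. Q e x y)" for e
  define hi where "hi e = (SOME y. Q e (lo e) y)" for e
  have Q: "Q e (lo e) (hi e)" if "e \<in> ?path" for e
    unfolding hi_def lo_def using ends[OF that] by (intro someI_ex[of "Q e _"]) (rule someI_ex)
  then have lh: "e = {lo e, hi e} \<and> lo e \<in> ?W \<and> hi e \<in> ?W \<and>
      pos (lo e) < pos (hi e) \<and> col (lo e) = col (hi e) \<and>
      (\<forall>z \<in> ?W. col z = col (hi e) \<longrightarrow> pos z \<le> pos (lo e) \<or> pos (hi e) \<le> pos z)"
    if "e \<in> ?path" for e using that unfolding Q_def by blast
  have "inj_on hi ?path"
  proof (rule inj_onI)
    fix e e' assume e: "e \<in> ?path" "e' \<in> ?path" and eq: "hi e = hi e'"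
    \<comment> \<open>Immediate predecessors are unique.\<close>
    have "pos (lo e) = pos (lo e')"
      using lh[OF e(1)] lh[OF e(2)] eq by (metis leD le_antisym)
    then have "lo e = lo e'" using lh[OF e(1)] lh[OF e(2)] inj by (meson inj_onD)
    then show "e = e'" using lh[OF e(1)] lh[OF e(2)] eq by metis
  qed
  moreover have "hi ` ?path \<subseteq> ?W - ?F"
  proof
    fix y assume "y \<in> hi ` ?path"
    then obtain e where e: "e \<in> ?path" "y = hi e" by blast
    have "hi e \<noteq> first c" if c: "c \<in> col ` ?W" for c
    proof
      assume eq: "hi e = first c"
      moreover obtain x where "x \<in> ?W" "c = col x" using c by blast
      ultimately have "c = col (hi e)" using first(2)[of x] by simp
      then have "pos (hi e) \<le> pos (lo e)" using first(3)[of "lo e"] lh[OF e(1)] eq by metis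
      then show False using lh[OF e(1)] by simp
    qed
    then have "hi e \<notin> ?F" by blast
    moreover have "hi e \<in> ?W" using lh[OF e(1)] by (elim conjE)
    ultimately show "y \<in> ?W - ?F" using e(2) by simp
  qed
  ultimately have path: "card ?path \<le> card (?W - ?F)"
    using finW by (intro card_inj_on_le[of hi]) auto
  have "card (?W - ?F) = card ?W - card ?F"
    using FW finW by (meson card_Diff_subset finite_subset)
  moreover have "card ?F \<le> card ?W" using FW finW by (rule card_mono[rotated])
  moreover have "card (edges G) = card ?hub + card ?path"
  proof -
    have "edges G = ?hub \<union> ?path" by blast
    then show ?thesis
      using finite_edges[OF G] card_Un_disjoint[of ?hub ?path] by fastforce
  qed
  ultimately show ?thesis using hub path cF by linarith
qed

lemma fan_on_density:
  fixes k m t :: nat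
  assumes "fan_on (\<lambda>c. if c = 0 then k + t else k) m col pos r G" "t \<le> k - 1" "k \<ge> 1"
  shows "edge_density G \<le> 2 - (real m + 2) / (real m * k + 1 + t)"
proof -
  let ?cap = "\<lambda>c :: nat. if c = 0 then k + t else k"
  let ?W = "verts G - {r}"
  define b where "b = card (col ` ?W)"
  define h where "h = card (verts G)"
  have G: "fin_sgraph G" and r: "r \<in> verts G" and colm: "col ` ?W \<subseteq> {..<m}"
    and cap: "\<And>c. c < m \<Longrightarrow> card {x \<in> ?W. col x = c} \<le> ?cap c"
    using assms(1) unfolding fan_on_def by blast+
  have finV: "finite (verts G)" using G by (simp add: fin_sgraph_def)
  have h: "h = card ?W + 1" using r finV card_gt_0_iff[of "verts G"] by (auto simp: h_def)
  have bm: "b \<le> m" using card_mono[OF _ colm] by (simp add: b_def)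
  have "card ?W = (\<Sum>c \<in> col ` ?W. card {x \<in> ?W. col x = c})"
    using finV sum.image_gen[of ?W "\<lambda>_. 1 :: nat" col] by simp
  \<comment> \<open>Only colour 0 may exceed \<open>k\<close>, so the surplus \<open>t\<close>
    enters at most once.\<close>
  also have "\<dots> \<le> (\<Sum>c \<in> col ` ?W. k + (if c = 0 then t else 0))"
  proof (rule sum_mono)
    fix c assume "c \<in> col ` ?W"
    then have "c < m" using colm by blast
    then show "card {x \<in> ?W. col x = c} \<le> k + (if c = 0 then t else 0)" using cap[of c] by auto
  qed
  also have "\<dots> \<le> b * k + t"
    using finV by (simp add: sum.distrib b_def)
  finally have hb: "h \<le> b * k + t + 1" using h by simp
  have "card (edges G) + b + 2 \<le> 2 * h"
    using fan_on_card_edges[OF assms(1)] h by (simp add: b_def)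
  then have e: "real (card (edges G)) \<le> 2 * real h - (real b + 2)" by linarith
  define n where "n = real m * k + 1 + t"
  have n0: "n > 0" by (simp add: n_def add_nonneg_pos add_pos_nonneg)
  have "(real m + 2) * h \<le> (real m + 2) * (real b * k + t + 1)"
    using hb by (intro mult_left_mono) (simp_all flip: of_nat_mult of_nat_add of_nat_Suc)
  also have "\<dots> \<le> (real b + 2) * n"
  proof -
    \<comment> \<open>This product is exactly the difference of the two sides being
      compared.\<close>
    have "0 \<le> (real m - real b) * (2 * real k - 1 - real t)"
      using bm assms(2,3) by (intro mult_nonneg_nonneg) auto
    then show ?thesis by (simp add: n_def algebra_simps)
  qed
  finally have "(real m + 2) / n \<le> (real b + 2) / h"
    using n0 h by (simp add: field_simps)
  moreover have "edge_density G \<le> (2 * real h - (real b + 2)) / h"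
    using e unfolding edge_density_def h_def by (intro divide_right_mono) auto
  moreover have "(2 * real h - (real b + 2)) / h = 2 - (real b + 2) / h"
    using h by (simp add: field_simps)
  ultimately show ?thesis by (simp add: n_def)
qed

section \<open>Fans realising the prescribed densities\<close>

lemma fan_minor_balanced:
  fixes k m t :: nat
  assumes "m \<ge> 1" "t \<le> k - 1" "k \<ge> 1"
  shows "\<exists>G :: nat ugraph. fin_sgraph G \<and> minor_balanced G \<and>
    edge_density G = 2 - (real m + 2) / (real m * k + 1 + t)"
proof -
  \<comment> \<open>The hub is 0 and the path vertices are 1 to \<open>L\<close>; \<open>J\<close>
    holds the \<open>x\<close> joined to x + 1. Breaks after t + jk make the first path run from 1
    to k + t and give the others \<open>k\<close> vertices each.\<close>
  define L where "L = m * k + t"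
  define J where "J = {1..<L} - (\<lambda>j. t + j * k) ` {1..<m}"
  define E where "E = (\<lambda>x. {0, x}) ` {1..L} \<union> (\<lambda>x. {x, Suc x}) ` J"
  define G :: "nat ugraph" where "G = ({0..L}, E)"
  \<comment> \<open>Truncated subtraction sends 1 to \<open>t\<close> to colour 0 as well, which
    gives that path its surplus.\<close>
  define col where "col x = (x - (t + 1)) div k" for x :: nat
  let ?cap = "\<lambda>c :: nat. if c = 0 then k + t else k"
  have L1: "L \<ge> 1" using assms by (simp add: L_def Suc_le_eq)
  have J: "x \<ge> 1" "x < L" if "x \<in> J" for x using that by (auto simp: J_def)
  have G: "fin_sgraph G"
    unfolding fin_sgraph_def G_def E_def using J by (auto simp: Suc_le_eq less_imp_le)
  \<comment> \<open>There are at most m - 1 breaks. A lower bound suffices, as the density bound for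
    fans supplies the other direction.\<close>
  have "card J \<ge> L - 1 - (m - 1)"
  proof -
    have "card ((\<lambda>j. t + j * k) ` {1..<m}) \<le> m - 1" using card_image_le[of "{1..<m}"] by simp
    then show ?thesis
      using diff_card_le_card_Diff[of "(\<lambda>j. t + j * k) ` {1..<m}" "{1..<L}"] by (simp add: J_def)
  qed
  moreover have "card E = L + card J"
  proof -
    have "inj_on (\<lambda>x :: nat. {0, x}) {1..L}" by (auto simp: inj_on_def doubleton_eq_iff)
    moreover have "inj_on (\<lambda>x :: nat. {x, Suc x}) J" by (auto simp: inj_on_def doubleton_eq_iff)
    moreover have "(\<lambda>x. {0, x}) ` {1..L} \<inter> (\<lambda>x. {x, Suc x}) ` J = {}"
      using J by (auto simp: doubleton_eq_iff) fastforce
    moreover have "finite J" by (simp add: J_def)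
    ultimately show ?thesis unfolding E_def by (simp add: card_Un_disjoint card_image)
  qed
  moreover have "m \<le> L" using assms by (simp add: L_def trans_le_add1)
  ultimately have cE: "card E + m \<ge> 2 * L" using assms(1) by linarith
  have colJ: "col (Suc x) = col x" if x: "x \<in> J" for x
  proof (cases "x \<le> t")
    case True
    then show ?thesis by (simp add: col_def)
  next
    case False
    \<comment> \<open>Beyond \<open>t\<close>, the colour changes after \<open>x\<close> only if
      \<open>k\<close> divides x - t, which is where \<open>J\<close> has its breaks.\<close>
    have "\<not> k dvd x - t"
    proof
      assume "k dvd x - t"
      then obtain j where j: "x = t + j * k" using False by (metis dvd_def le_add_diff_inverse mult.commute nat_le_linear)
      then have "j \<ge> 1" using False by (cases j) auto
      moreover have "j < m" using J(2)[OF x] j by (simp add: L_def)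
      ultimately show False using x j by (auto simp: J_def)
    qed
    moreover have "x - t = Suc (x - (t + 1))" using False by simp
    ultimately show ?thesis
      by (simp add: col_def div_Suc dvd_eq_mod_eq_0)
  qed
  have fan: "fan_on ?cap m col id 0 G"
  proof -
    have W: "verts G - {0} = {1..L}" by (auto simp: G_def)
    have "col x < m" if "x \<in> {1..L}" for x
    proof -
      have "m * k > 0" using assms by simp
      then have "x - (t + 1) < m * k" using that unfolding L_def by (cases "x \<le> t") auto
      then show ?thesis using assms(3) by (simp add: col_def div_less_iff_less_mult)
    qed
    moreover have "card {x \<in> {1..L}. col x = c} \<le> ?cap c" for c
    proof (cases "c = 0")
      case True
      have "{x \<in> {1..L}. col x = c} \<subseteq> {1..k + t}"
        using True assms(3) by (auto simp: col_def div_eq_0_iff)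
      then show ?thesis using True card_mono[of "{1..k + t}"] by fastforce
    next
      case False
      have "{x \<in> {1..L}. col x = c} \<subseteq> {t + 1 + c * k..<t + 1 + c * k + k}"
      proof
        fix x assume "x \<in> {x \<in> {1..L}. col x = c}"
        then have "(x - (t + 1)) div k = c" by (simp add: col_def)
        then have "c * k \<le> x - (t + 1)" "x - (t + 1) < c * k + k"
          using div_mult_mod_eq[of "x - (t + 1)" k] mod_less_divisor[of k "x - (t + 1)"] assms(3)
          by (auto simp del: mod_less_divisor)
        moreover have "c * k > 0" using False assms(3) by simp
        ultimately show "x \<in> {t + 1 + c * k..<t + 1 + c * k + k}"
          unfolding atLeastLessThan_iff by linarith
      qed
      then show ?thesis using False card_mono[of "{t + 1 + c * k..<t + 1 + c * k + k}"] by fastforce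
    qed
    moreover have "col x = col y \<and> \<not> (\<exists>z \<in> {1..L}. col z = col x \<and> in_between id x y z)"
      if xy: "{x, y} \<in> edges G" "x \<noteq> 0" "y \<noteq> 0" for x y
    proof -
      obtain z where "z \<in> J" "{x, y} = {z, Suc z}"
        using xy by (auto simp: G_def E_def doubleton_eq_iff)
      then show ?thesis using colJ[of z] by (auto simp: doubleton_eq_iff in_between_def)
    qed
    ultimately show ?thesis
      unfolding fan_on_def W using G by (auto simp: G_def)
  qed
  let ?\<rho> = "2 - (real m + 2) / (real m * k + 1 + t)"
  have fan_minor: "\<exists>s. fan_on ?cap m col id s H" if "minor_step\<^sup>*\<^sup>* G H" for H
    using that
  proof (induction rule: rtranclp_induct)
    case base
    then show ?case using fan by blast
  next
    case (step y z)
    then obtain s where s: "fan_on ?cap m col id s y" by blast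
    show ?case by (rule fan_on_minor_step[OF s step.hyps(2)])
  qed
  have "real (card E) \<ge> 2 * real L - m" using cE by linarith
  then have "edge_density G \<ge> (2 * real L - m) / (L + 1)"
    unfolding edge_density_def G_def by (simp add: divide_right_mono)
  moreover have "(2 * real L - m) / (L + 1) = ?\<rho>"
  proof -
    have "(2 * real L - m) / (L + 1) = 2 - (real m + 2) / (L + 1)" by (simp add: field_simps)
    then show ?thesis by (simp add: L_def algebra_simps)
  qed
  moreover have "edge_density G \<le> ?\<rho>" by (rule fan_on_density[OF fan assms(2,3)])
  ultimately have dG: "edge_density G = ?\<rho>" by linarith
  have "minor_balanced G"
    unfolding minor_balanced_def
  proof (intro allI impI)
    fix H :: "nat ugraph" assume "minor_of H G"
    then obtain H' where H': "minor_step\<^sup>*\<^sup>* G H'" "graph_iso H' H" by (auto simp: minor_of_def)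
    obtain s where s: "fan_on ?cap m col id s H'" using fan_minor[OF H'(1)] by blast
    then have "edge_density H = edge_density H'"
      using H'(2) by (intro edge_density_iso) (simp_all add: fan_on_def)
    then show "edge_density H \<le> edge_density G"
      using fan_on_density[OF s assms(2,3)] dG by simp
  qed
  then show ?thesis using G dG by blast
qed

section \<open>Values of critical densities\<close>

text \<open>For d < k, multiples of \<open>d\<close> cannot jump over an interval of
  \<open>k\<close> integers; the factor used is k/d rounded up. A larger \<open>d\<close> lies in
  the interval itself.\<close>

lemma multiple_in_interval:
  fixes d k :: nat
  assumes "1 \<le> d" "d \<le> 2 * k - 1"
  shows "\<exists>j\<ge>1. k \<le> j * d \<and> j * d \<le> 2 * k - 1"
proof (cases "k \<le> d")
  case True
  then show ?thesis using assms by (intro exI[of _ 1]) auto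
next
  case False
  define j where "j = (k + d - 1) div d"
  have "j * d + (k + d - 1) mod d = k + d - 1" by (simp add: j_def)
  moreover have "(k + d - 1) mod d < d" using assms by simp
  ultimately have "k \<le> j * d" "j * d \<le> k + d - 1" using assms by linarith+
  moreover have "j \<ge> 1" using \<open>k \<le> j * d\<close> False by (cases j) auto
  ultimately show ?thesis using False by (intro exI[of _ j]) auto
qed

text \<open>With \<open>c = 2n - e\<close> and \<open>d = ck - n\<close>, the density \<open>e/n = 2 - c/n\<close> does not change if \<open>c\<close> and
  \<open>n\<close> are multiplied by \<open>j\<close>. Taking \<open>jd\<close> between \<open>k\<close> and \<open>2k - 1\<close> brings \<open>t = 2k - 1 - jd\<close>
  into the required range.\<close>

lemma density_value:
  fixes k n e :: nat
  assumes "k \<ge> 2" "n \<ge> 1"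
    and lower: "real e / n > 2 - 1 / (real k - 1)" and upper: "real e / n < 2 - 1 / real k"
    and bound: "(2 * real k - 1) * (real n - 1) \<le> real k * e"
  shows "\<exists>m t N :: nat. m \<ge> 1 \<and> t \<le> k - 1 \<and> N = m * k + 1 + t \<and>
    real N > (2 * real k - 1 - real t) * (real k - 1) \<and>
    real e / n = 2 - 1 / real k - (2 * real k - real t - 1) / (real k * real N)"
proof -
  have k: "real k > 1" and n: "real n > 0" using assms by auto
  have up: "real n < (2 * real n - e) * k" using upper k n by (simp add: field_simps)
  then have "2 * real n - e > 0" using n k by (smt (verit) mult_nonpos_nonneg)
  then have "e < 2 * n" by linarith
  define c where "c = 2 * n - e"
  have c: "real c = 2 * real n - e" using \<open>e < 2 * n\<close> by (simp add: c_def of_nat_diff)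
  have low: "real c * (real k - 1) < n" using lower k n by (simp add: c field_simps)
  have "real n < real (c * k)" using up c by simp
  then have nck: "n < c * k" by linarith
  define d where "d = c * k - n"
  have d: "real d = real c * k - n" using nck by (simp add: d_def of_nat_diff)
  \<comment> \<open>In terms of \<open>c\<close> and \<open>d\<close>, the hypothesis
    \<open>bound\<close> reads d \<le> 2k - 1.\<close>
  have "real d \<le> 2 * real k - 1" using bound by (simp add: d c algebra_simps)
  then have "d \<le> 2 * k - 1" using assms(1) by linarith
  moreover have "1 \<le> d" using nck by (simp add: d_def)
  ultimately obtain j where j: "j \<ge> 1" "k \<le> j * d" "j * d \<le> 2 * k - 1"
    using multiple_in_interval by blast
  \<comment> \<open>The lower bound on the density gives d < c. With jd \<ge> k \<ge> 2 this makes
    jc at least 3, hence \<open>m\<close> positive.\<close>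
  have "real d < c" using low by (simp add: d algebra_simps)
  then have "j * d < j * c" using j by simp
  then have jc: "3 \<le> j * c" using j assms(1) by linarith
  \<comment> \<open>Chosen so that the fan density 2 - (m + 2)/N equals 2 - jc/(jn).\<close>
  define m where "m = j * c - 2"
  define t where "t = 2 * k - 1 - j * d"
  define N where "N = j * n"
  have m: "real m = real j * c - 2" and t: "real t = 2 * real k - 1 - real j * d"
    using jc j assms(1) by (simp_all add: m_def t_def of_nat_diff)
  have N: "real N = real m * k + 1 + t" by (simp add: N_def m t d algebra_simps)
  have j0: "real j > 0" using j by simp
  have N0: "real N > 0" using j n by (simp add: N_def)
  have "m \<ge> 1" "t \<le> k - 1" using jc j by (auto simp: m_def t_def)
  moreover have "N = m * k + 1 + t" using N by (simp flip: of_nat_mult of_nat_add of_nat_Suc)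
  moreover have "real N > (2 * real k - 1 - real t) * (real k - 1)"
  proof -
    have "real k * (real c * (real k - 1)) < real k * n" using low k by simp
    then have "real d * (real k - 1) < n" by (simp add: d algebra_simps)
    then have "real j * (real d * (real k - 1)) < real j * n" using j0 by simp
    then show ?thesis by (simp add: N_def t algebra_simps)
  qed
  moreover have "real e / n = 2 - 1 / real k - (2 * real k - real t - 1) / (real k * real N)"
  proof -
    have "(2 * real k - real t - 1) / (real k * real N) = real d / (real k * n)"
      using j0 by (simp add: t N_def field_simps)
    moreover have "real e / n = 2 - 1 / real k - real d / (real k * n)"
      using k n by (simp add: d c field_simps)
    ultimately show ?thesis by simp
  qed
  ultimately show ?thesis by blast
qed

text \<open>Rests on k(m + 2) = n + (2k - 1 - t) for n = mk + 1 + t.\<close>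

lemma fan_density_eq:
  fixes k m t :: nat
  assumes "k \<ge> 1"
  shows "2 - (real m + 2) / (real m * k + 1 + t)
    = 2 - 1 / real k - (2 * real k - real t - 1) / (real k * (real m * k + 1 + t))"
proof -
  define n where "n = real m * k + 1 + t"
  have n: "n > 0" by (simp add: n_def add_nonneg_pos add_pos_nonneg)
  have "(real m + 2) / n = 1 / real k + (2 * real k - real t - 1) / (real k * n)"
    using n assms by (simp add: field_simps) (simp add: n_def algebra_simps)
  then show ?thesis by (simp add: n_def)
qed

section \<open>Attainment of the supremum\<close>

lemma sup_density_attained:
  fixes k :: nat
  assumes "graph_class A" "minor_closed A" "k \<ge> 2"
    and "ereal (2 - 1 / (real k - 1)) < sup_density A" "sup_density A < ereal (2 - 1 / real k)"
  obtains G where "G \<in> A" "sup_density A = ereal (edge_density G)"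
proof -
  let ?\<gamma> = "2 - 1 / (real k - 1)"
  obtain \<beta> where \<beta>: "sup_density A = ereal \<beta>"
    using assms(4,5) by (cases "sup_density A") auto
  have \<beta>k: "\<beta> < 2 - 1 / real k" using assms(5) \<beta> by simp
  have le: "edge_density G \<le> \<beta>" if "G \<in> A" for G
    using SUP_upper[OF that, of "\<lambda>G. ereal (edge_density G)"] \<beta> by (simp add: sup_density_def)
  \<comment> \<open>Bounds the order of critical members above the threshold: (2 - 1/k)(n - 1) \<le>
    e and e \<le> \<beta>n, solved for \<open>n\<close>, give this quotient.\<close>
  obtain N :: nat where N: "(2 - 1 / real k) / (2 - 1 / real k - \<beta>) \<le> N"
    using real_arch_simple by blast
  define D where "D = edge_density ` {G \<in> A. card (verts G) \<le> N}"
  have fin: "fin_sgraph G" if "G \<in> A" for G using assms(1) that by (simp add: graph_class_def)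
  \<comment> \<open>A density depends only on the two counts, and the crude bound
    \<open>2 ^ N\<close> on the edges leaves finitely many pairs.\<close>
  have "D \<subseteq> (\<lambda>(e, n). real e / real n) ` ({..2 ^ N} \<times> {..N})"
  proof
    fix \<rho> assume "\<rho> \<in> D"
    then obtain G where G: "G \<in> A" "card (verts G) \<le> N" "\<rho> = edge_density G"
      by (auto simp: D_def)
    have "finite (verts G)" "edges G \<subseteq> Pow (verts G)" using fin[OF G(1)] by (auto simp: fin_sgraph_def)
    then have "card (edges G) \<le> 2 ^ card (verts G)" by (metis card_Pow card_mono finite_Pow_iff)
    also have "\<dots> \<le> 2 ^ N" using G(2) by (intro power_increasing) auto
    finally show "\<rho> \<in> (\<lambda>(e, n). real e / real n) ` ({..2 ^ N} \<times> {..N})"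
      using G by (auto simp: edge_density_def intro!: rev_image_eqI[of "(card (edges G), card (verts G))"])
  qed
  then have finD: "finite D" by (rule finite_subset) simp
  \<comment> \<open>A critical member for the threshold \<open>edge_density G\<close> is at least as
    dense and has at most \<open>N\<close> vertices.\<close>
  have small: "\<exists>\<rho> \<in> D. edge_density G \<le> \<rho>" if G: "G \<in> A" "edge_density G > ?\<gamma>" for G
  proof -
    obtain H where H: "H \<in> A" "critical (edge_density G) H"
      using critical_exists[OF assms(1,2) G(1) order_refl] by blast
    let ?n = "real (card (verts H))"
    have n0: "?n > 0" using fin[OF H(1)] by (auto simp: fin_sgraph_def card_gt_0_iff)
    have "(2 * real k - 1) * (?n - 1) \<le> real k * card (edges H)"
      by (rule critical_edge_bound[OF H(2) G(2) assms(3)])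
    also have "card (edges H) \<le> \<beta> * ?n"
      using le[OF H(1)] n0 by (simp add: edge_density_def field_simps)
    finally have "(2 * real k - 1) * (?n - 1) \<le> real k * (\<beta> * ?n)" by (simp add: mult_left_mono)
    then have "(2 - 1 / real k) * (?n - 1) \<le> \<beta> * ?n"
      using assms(3) by (simp add: field_simps)
    then have "?n * (2 - 1 / real k - \<beta>) \<le> 2 - 1 / real k" by (simp add: algebra_simps)
    then have "?n \<le> (2 - 1 / real k) / (2 - 1 / real k - \<beta>)"
      using \<beta>k by (simp add: pos_le_divide_eq)
    then have "card (verts H) \<le> N" using N by linarith
    moreover have "edge_density G \<le> edge_density H" using H(2) by (simp add: critical_def)
    ultimately show ?thesis using H(1) unfolding D_def by blast
  qed
  obtain G where G: "G \<in> A" "edge_density G > ?\<gamma>"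
    using assms(4) unfolding sup_density_def less_SUP_iff by auto
  have neD: "D \<noteq> {}" using small[OF G] by blast
  obtain M where M: "M \<in> A" "edge_density M = Max D"
    using Max_in[OF finD neD] by (auto simp: D_def)
  have "edge_density H \<le> Max D" if H: "H \<in> A" for H
  proof -
    have *: "edge_density K \<le> Max D" if "K \<in> A" "edge_density K > ?\<gamma>" for K
      using small[OF that] finD by (meson Max_ge order_trans)
    \<comment> \<open>A member not above the threshold is less dense than \<open>G\<close>, whose
      density is at most the maximum.\<close>
    show ?thesis using *[OF H] *[OF G] G(2) by linarith
  qed
  then have "sup_density A \<le> ereal (edge_density M)"
    unfolding sup_density_def by (intro SUP_least) (simp add: M)
  moreover have "ereal (edge_density M) \<le> sup_density A"
    unfolding sup_density_def using M(1) by (rule SUP_upper)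
  ultimately show ?thesis using that[OF M(1)] by simp
qed

theorem theorem4:
  fixes A :: "nat ugraph set" and k :: nat
  assumes "graph_class A" and "proper_class A" and "minor_closed A"
    and "k \<ge> 2"
    and "ereal (2 - 1 / (real k - 1)) \<le> sup_density A"
    and "sup_density A < ereal (2 - 1 / real k)"
  shows "(sup_density A = ereal (2 - 1 / (real k - 1)) \<or>
          (\<exists>m t n :: nat. m \<ge> 1 \<and> t \<le> k - 1 \<and> n = m * k + 1 + t \<and>
             real n > (2 * real k - 1 - real t) * (real k - 1) \<and>
             sup_density A =
               ereal (2 - 1 / real k - (2 * real k - real t - 1) / (real k * real n))))
       \<and> ((\<exists>G :: nat ugraph. fin_sgraph G \<and> minor_balanced G \<and>
             edge_density G = 2 - 1 / (real k - 1)) \<and>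
          (\<forall>m t n :: nat. m \<ge> 1 \<and> t \<le> k - 1 \<and> n = m * k + 1 + t \<and>
             real n > (2 * real k - 1 - real t) * (real k - 1) \<longrightarrow>
             (\<exists>G :: nat ugraph. fin_sgraph G \<and> minor_balanced G \<and>
                edge_density G =
                  2 - 1 / real k - (2 * real k - real t - 1) / (real k * real n))))"
proof (intro conjI allI impI)
  show "sup_density A = ereal (2 - 1 / (real k - 1)) \<or>
          (\<exists>m t n :: nat. m \<ge> 1 \<and> t \<le> k - 1 \<and> n = m * k + 1 + t \<and>
             real n > (2 * real k - 1 - real t) * (real k - 1) \<and>
             sup_density A =
               ereal (2 - 1 / real k - (2 * real k - real t - 1) / (real k * real n)))"
  proof (cases "sup_density A = ereal (2 - 1 / (real k - 1))")
    case False
    then have gt: "ereal (2 - 1 / (real k - 1)) < sup_density A" using assms(5) by simp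
    obtain M where M: "M \<in> A" "sup_density A = ereal (edge_density M)"
      using sup_density_attained[OF assms(1,3,4) gt assms(6)] by blast
    \<comment> \<open>\<open>M\<close> attains the supremum but need not be critical. A critical
      member for its density has the same density, since the supremum caps it.\<close>
    obtain G where G: "G \<in> A" "critical (edge_density M) G"
      using critical_exists[OF assms(1,3) M(1) order_refl] by blast
    have "ereal (edge_density G) \<le> sup_density A"
      unfolding sup_density_def using G(1) by (rule SUP_upper)
    then have eq: "edge_density G = edge_density M" using G(2) M(2) by (simp add: critical_def)
    have low: "edge_density M > 2 - 1 / (real k - 1)" using gt M(2) by simp
    have "card (verts G) \<ge> 1"
      using G(2) by (auto simp: critical_def fin_sgraph_def Suc_le_eq card_gt_0_iff)
    then have "\<exists>m t N :: nat. m \<ge> 1 \<and> t \<le> k - 1 \<and> N = m * k + 1 + t \<and>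
        real N > (2 * real k - 1 - real t) * (real k - 1) \<and>
        edge_density G = 2 - 1 / real k - (2 * real k - real t - 1) / (real k * real N)"
      unfolding edge_density_def
      using critical_edge_bound[OF G(2) low assms(4)] low assms(4,6) M(2) eq
      by (intro density_value) (simp_all add: edge_density_def)
    then show ?thesis using eq M(2) by metis
  qed simp
next
  \<comment> \<open>For m = 2k - 3 and t = 0, \<open>n\<close> factors as (2k - 1)(k - 1) and m + 2
    = 2k - 1 cancels. This is the case of equality in the strict condition on
    \<open>n\<close>.\<close>
  have eq: "real (2 * k - 3) = 2 * real k - 3" using assms(4) by (simp add: of_nat_diff)
  have "2 - (real (2 * k - 3) + 2) / (real (2 * k - 3) * k + 1 + real 0) = 2 - 1 / (real k - 1)"
  proof -
    have "real (2 * k - 3) * k + 1 + real 0 = (2 * real k - 1) * (real k - 1)"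
      unfolding eq by (simp add: algebra_simps)
    then show ?thesis using assms(4) by (simp add: eq)
  qed
  then show "\<exists>G :: nat ugraph. fin_sgraph G \<and> minor_balanced G \<and>
      edge_density G = 2 - 1 / (real k - 1)"
    using fan_minor_balanced[of "2 * k - 3" 0 k] assms(4) by auto
next
  fix m t n :: nat
  assume mtn: "m \<ge> 1 \<and> t \<le> k - 1 \<and> n = m * k + 1 + t \<and>
    real n > (2 * real k - 1 - real t) * (real k - 1)"
  then have n: "real n = real m * k + 1 + t" by simp
  show "\<exists>G :: nat ugraph. fin_sgraph G \<and> minor_balanced G \<and>
      edge_density G = 2 - 1 / real k - (2 * real k - real t - 1) / (real k * real n)"
    unfolding n using fan_minor_balanced[of m t k] fan_density_eq[of k m t] mtn assms(4) by simp
qed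

end
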